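(* Let $F$ be a perfect field with $\mathrm{char}(F)\neq 2$, let $g\geq 1$ be an integer, and let $f(x)=x^{2g+1}+a_1x^{2g}+a_2x^{2g-1}+\cdots+a_{2g}x+a_{2g+1}$ be an irreducible polynomial over $F$. Let $F_f$ be the minimal splitting field of $f(x)$ over $F$ and let $\mathrm{Gal}(F_f/F)$ be its Galois group. Then $\mathrm{Gal}(F_f/F)$ is (isomorphic to) a subgroup of $GL_{2g}(\mathbb{F}_2)$.
   Context: $\mathbb{F}_2$ is the field with two elements and $GL_{2g}(\mathbb{F}_2)$ is the general linear group of invertible $2g\times 2g$ matrices over $\mathbb{F}_2$. *)

theory Defs
  imports
    "HOL-Algebra.Polynomial_Divisibility"
    "HOL-Algebra.Generated_Fields"
    "HOL-Algebra.Bij"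
    "HOL-Library.Z2"
    "Jordan_Normal_Form.Matrix"
begin

definition ring_char :: "('a, 'm) ring_scheme \<Rightarrow> nat" where
  "ring_char R = (if \<exists>n>0. [(n::nat)] \<cdot>\<^bsub>R\<^esub> \<one>\<^bsub>R\<^esub> = \<zero>\<^bsub>R\<^esub>
                  then LEAST n. 0 < n \<and> [(n::nat)] \<cdot>\<^bsub>R\<^esub> \<one>\<^bsub>R\<^esub> = \<zero>\<^bsub>R\<^esub>
                  else 0)"

text \<open>Perfect: characteristic zero, or characteristic \<open>p\<close> with surjective Frobenius map.\<close>

definition perfect_field :: "('a, 'm) ring_scheme \<Rightarrow> bool" where
  "perfect_field F \<longleftrightarrow> field F \<and>
     (ring_char F = 0 \<or>
      (\<forall>x\<in>carrier F. \<exists>y\<in>carrier F. y [^]\<^bsub>F\<^esub> ring_char F = x))"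

text \<open>
  The extension field \<open>L\<close> of \<open>F\<close> is given together with its embedding \<open>h\<close>, so that \<open>F\<close> and
  \<open>L\<close> may live on different types; \<open>map h f\<close> is \<open>f\<close> regarded as a polynomial over \<open>L\<close>.
  The last condition is the minimality of \<open>L\<close>: it is generated over \<open>F\<close> by the roots of \<open>f\<close>.
\<close>

definition splitting_field ::
    "('a, 'm) ring_scheme \<Rightarrow> 'a list \<Rightarrow> ('b, 'n) ring_scheme \<Rightarrow> ('a \<Rightarrow> 'b) \<Rightarrow> bool" where
  "splitting_field F f L h \<longleftrightarrow>
     field L \<and> h \<in> Ring.ring_hom F L \<and>
     ring.splitted L (map h f) \<and>
     generate_field L (h ` carrier F \<union> set_mset (ring.roots L (map h f))) = carrier L"

text \<open>
  The group of automorphisms of \<open>L\<close> fixing \<open>K\<close> pointwise, under composition. As in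
  \<^const>\<open>BijGroup\<close>, automorphisms are taken to be extensional so that equality of group elements
  is equality of maps on the carrier of \<open>L\<close>.
\<close>

definition galois_group :: "('b, 'n) ring_scheme \<Rightarrow> 'b set \<Rightarrow> ('b \<Rightarrow> 'b) monoid" where
  "galois_group L K =
     BijGroup (carrier L)
       \<lparr>carrier := {\<sigma> \<in> ring_iso L L \<inter> extensional (carrier L). \<forall>x\<in>K. \<sigma> x = x}\<rparr>"

text \<open>The type \<^typ>\<open>bit\<close> is the field with two elements.\<close>

definition GL_bit :: "nat \<Rightarrow> bit mat monoid" where
  "GL_bit n = units_of (ring_mat TYPE(bit) n ())"

end

theory Submission
  imports Defs
begin

text \<open>
  The Galois group acts on the set \<open>E\<close> of roots of \<open>f\<close> in \<open>L\<close>. The action is faithful because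
  \<open>L\<close> is generated by \<open>E\<close> over the image of \<open>F\<close> (\<open>galois_fixing_generators_is_one\<close>), so the
  group embeds into the symmetric group of \<open>E\<close>, and \<open>E\<close> has at most \<open>deg f = 2g+1\<close> elements.

  It remains to represent the symmetric group on \<open>n+1\<close> points, \<open>n \<ge> 2\<close>, faithfully in dimension
  \<open>n\<close> over the field with two elements, and to take \<open>n = 2g\<close>. In the permutation module with basis
  \<open>e\<^sub>0, \<dots>, e\<^sub>n\<close> the vectors of coordinate sum zero form an invariant subspace of dimension
  \<open>n\<close>; the matrices below describe the action on it in the basis \<open>e\<^sub>i + e\<^sub>n\<close>, \<open>i < n\<close>.
  If \<open>f\<close> is separable and the characteristic is not 2, this is the action on the 2-torsion of the
  Jacobian of the hyperelliptic curve \<open>y\<^sup>2 = f(x)\<close>.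
\<close>

section \<open>The permutation representation on vectors of coordinate sum zero\<close>

text \<open>
  Column \<open>j\<close> holds the coordinates of \<open>e\<^bsub>p j\<^esub> + e\<^bsub>p n\<^esub>\<close>, the image of \<open>e\<^sub>j + e\<^sub>n\<close>: since
  \<open>1 + 1 = 0\<close>, this vector is the sum of \<open>e\<^bsub>p j\<^esub> + e\<^sub>n\<close> and \<open>e\<^bsub>p n\<^esub> + e\<^sub>n\<close>, each of which is
  a basis vector or, if \<open>p j = n\<close> or \<open>p n = n\<close> respectively, zero.
\<close>

definition sum_zero_mat :: "nat \<Rightarrow> (nat \<Rightarrow> nat) \<Rightarrow> bit mat" where
  "sum_zero_mat n p = mat n n (\<lambda>(i, j). of_bool (p j = i) + of_bool (p n = i))"

lemma sum_zero_mat_carrier [simp]: "sum_zero_mat n p \<in> carrier_mat n n"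
  by (simp add: sum_zero_mat_def)

lemma sum_zero_mat_one:
  assumes "\<And>i. i \<le> n \<Longrightarrow> p i = i"
  shows "sum_zero_mat n p = 1\<^sub>m n"
  by (rule eq_matI) (use assms in \<open>auto simp: sum_zero_mat_def\<close>)

lemma sum_zero_mat_mult:
  assumes q: "\<And>i. i \<le> n \<Longrightarrow> q i \<le> n" and r: "\<And>i. i \<le> n \<Longrightarrow> r i = p (q i)"
  shows "sum_zero_mat n r = sum_zero_mat n p * sum_zero_mat n q"
proof (rule eq_matI)
  fix i j assume "i < dim_row (sum_zero_mat n p * sum_zero_mat n q)"
    and "j < dim_col (sum_zero_mat n p * sum_zero_mat n q)"
  then have ij: "i < n" "j < n" by (simp_all add: sum_zero_mat_def)
  define c :: "nat \<Rightarrow> bit" where "c k = of_bool (p k = i) + of_bool (p n = i)" for k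
  \<comment> \<open>The index \<open>k = n\<close> may be added to the sum that defines the product, as \<open>c n = 0\<close>; then
    every value of \<open>q\<close> occurs as an index.\<close>
  have "(sum_zero_mat n p * sum_zero_mat n q) $$ (i, j)
      = (\<Sum>k<n. c k * (of_bool (q j = k) + of_bool (q n = k)))"
    using ij by (simp add: sum_zero_mat_def scalar_prod_def c_def lessThan_atLeast0)
  also have "\<dots> = (\<Sum>k\<le>n. c k * (of_bool (q j = k) + of_bool (q n = k)))"
    by (simp add: lessThan_Suc_atMost[symmetric] c_def)
  also have "\<dots> = (\<Sum>k\<le>n. c k * of_bool (q j = k)) + (\<Sum>k\<le>n. c k * of_bool (q n = k))"
    by (simp only: distrib_left sum.distrib)
  also have "\<dots> = c (q j) + c (q n)"
  proof -
    have "(\<Sum>k\<le>n. c k * of_bool (m = k)) = c m" if "m \<le> n" for m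
    proof -
      have "(\<Sum>k\<le>n. c k * of_bool (m = k)) = (\<Sum>k\<le>n. if m = k then c k else 0)"
        by (intro sum.cong) auto
      also have "\<dots> = c m" using that by (simp only: sum.delta' finite_atMost atMost_iff if_True)
      finally show ?thesis .
    qed
    then show ?thesis using q[of j] q[of n] ij by simp
  qed
  also have "\<dots> = of_bool (p (q j) = i) + of_bool (p (q n) = i)"
    by (simp add: c_def)
  finally show "sum_zero_mat n r $$ (i, j) = (sum_zero_mat n p * sum_zero_mat n q) $$ (i, j)"
    using ij r by (simp add: sum_zero_mat_def)
qed (simp_all add: sum_zero_mat_def)

text \<open>
  The bound \<open>n \<ge> 2\<close> is sharp: for \<open>n = 1\<close> the transposition of the two points fixes the only
  basis vector \<open>e\<^sub>0 + e\<^sub>1\<close>. For larger \<open>n\<close> two distinct columns are available, and they suffice to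
  show that \<open>p\<close> fixes \<open>n\<close>; then the matrix is the permutation matrix of \<open>p\<close> on \<open>{0..<n}\<close>.
\<close>

lemma sum_zero_mat_eq_one_imp_id:
  assumes n: "2 \<le> n" and inj: "inj_on p {..n}" and p: "\<And>i. i \<le> n \<Longrightarrow> p i \<le> n"
    and one: "sum_zero_mat n p = 1\<^sub>m n" and i: "i \<le> n"
  shows "p i = i"
proof -
  have entry: "(of_bool (p j = k) + of_bool (p n = k) :: bit) = of_bool (j = k)"
    if "j < n" "k < n" for j k
    using arg_cong[OF one, of "\<lambda>A. A $$ (k, j)"] that
    by (auto simp: sum_zero_mat_def)
  have eq: "p j = p k \<longleftrightarrow> j = k" if "j \<le> n" "k \<le> n" for j k
    using inj that by (auto simp: inj_on_def)
  have pn: "p n = n"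
  proof (rule ccontr)
    assume "p n \<noteq> n"
    then have "p n < n" using p[of n] by simp
    \<comment> \<open>A second index below \<open>n\<close> would also have to be sent to \<open>p n\<close>.\<close>
    obtain j where "j < n" "j \<noteq> p n"
      using n by (cases "p n = 0") (auto intro: that[of 0] that[of 1])
    then show False
      using entry[of j "p n"] eq[of j n] \<open>p n < n\<close> by simp
  qed
  show ?thesis
  proof (cases "i = n")
    case False
    then have "i < n" using i by simp
    then show ?thesis
      using entry[of i i] pn by (auto simp: of_bool_def split: if_splits)
  qed (simp add: pn)
qed

section \<open>Symmetric groups inside general linear groups\<close>

lemma GL_bit_simps:
  "carrier (GL_bit n) = {A \<in> carrier_mat n n. \<exists>B \<in> carrier_mat n n. B * A = 1\<^sub>m n \<and> A * B = 1\<^sub>m n}"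
  "A \<otimes>\<^bsub>GL_bit n\<^esub> B = A * B"
  "\<one>\<^bsub>GL_bit n\<^esub> = 1\<^sub>m n"
  by (simp_all add: GL_bit_def units_of_def Units_def ring_mat_simps)

lemma group_GL_bit: "group (GL_bit n)"
proof -
  interpret ring "ring_mat TYPE(bit) n ()" by (rule ring_mat)
  show ?thesis unfolding GL_bit_def by (rule units_group)
qed

text \<open>
  A set with at most \<open>n+1\<close> elements is identified with a subset of \<open>{0..n}\<close>; a bijection of it is
  extended to \<open>{0..n}\<close> by the identity.
\<close>

lemma BijGroup_embeds_GL_bit:
  assumes n: "2 \<le> n" and fin: "finite E" and card: "card E \<le> Suc n"
  obtains \<phi> where "\<phi> \<in> hom (BijGroup E) (GL_bit n)" and "inj_on \<phi> (carrier (BijGroup E))"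
proof -
  obtain \<iota> where \<iota>: "inj_on \<iota> E" "\<iota> ` E \<subseteq> {..n}"
    using card_le_inj[OF fin, of "{..n}"] card by auto
  define T where "T s i = (if i \<in> \<iota> ` E then \<iota> (s (inv_into E \<iota> i)) else i)" for s i
  define \<phi> where "\<phi> s = sum_zero_mat n (T s)" for s
  have T_im: "T s (\<iota> x) = \<iota> (s x)" if "x \<in> E" for s x
    using that \<iota> by (simp add: T_def)
  have T_out: "T s i = i" if "i \<notin> \<iota> ` E" for s i
    using that by (simp add: T_def)
  have Bij_mem: "s x \<in> E" if "s \<in> Bij E" "x \<in> E" for s x
    using Bij_imp_funcset[OF that(1)] that(2) by auto
  have T_le: "T s i \<le> n" if "s \<in> Bij E" "i \<le> n" for s i
    using that Bij_mem \<iota>(2) by (cases "i \<in> \<iota> ` E") (auto simp: T_im T_out image_subset_iff)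
  have T_comp: "T (s \<otimes>\<^bsub>BijGroup E\<^esub> t) i = T s (T t i)" if "s \<in> Bij E" "t \<in> Bij E" for s t i
    using that Bij_mem
    by (cases "i \<in> \<iota> ` E") (auto simp: T_im T_out BijGroup_def compose_def)
  have T_one: "T \<one>\<^bsub>BijGroup E\<^esub> i = i" for i
    by (cases "i \<in> \<iota> ` E") (auto simp: T_im T_out BijGroup_def)
  have T_inj: "inj_on (T s) {..n}" if s: "s \<in> Bij E" for s
  proof (rule inj_on_inverseI)
    interpret group "BijGroup E" by (rule group_BijGroup)
    have "s \<in> carrier (BijGroup E)" using s by (simp add: BijGroup_def)
    then have "inv\<^bsub>BijGroup E\<^esub> s \<in> Bij E" "inv\<^bsub>BijGroup E\<^esub> s \<otimes>\<^bsub>BijGroup E\<^esub> s = \<one>\<^bsub>BijGroup E\<^esub>"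
      using inv_closed l_inv by (auto simp: BijGroup_def)
    then show "T (inv\<^bsub>BijGroup E\<^esub> s) (T s i) = i" for i
      using T_comp[of "inv\<^bsub>BijGroup E\<^esub> s" s i] s by (simp add: T_one)
  qed
  have \<phi>_one: "\<phi> \<one>\<^bsub>BijGroup E\<^esub> = 1\<^sub>m n"
    unfolding \<phi>_def by (rule sum_zero_mat_one) (rule T_one)
  have \<phi>_mult: "\<phi> (s \<otimes>\<^bsub>BijGroup E\<^esub> t) = \<phi> s * \<phi> t" if "s \<in> Bij E" "t \<in> Bij E" for s t
    unfolding \<phi>_def by (rule sum_zero_mat_mult) (use that T_le T_comp in auto)
  have car: "carrier (BijGroup E) = Bij E" by (simp add: BijGroup_def)
  interpret group "BijGroup E" by (rule group_BijGroup)
  have \<phi>_inv: "\<phi> s \<in> carrier (GL_bit n)" if s: "s \<in> Bij E" for s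
  proof -
    have t: "inv\<^bsub>BijGroup E\<^esub> s \<in> Bij E" using s inv_closed by (simp add: car)
    have "\<phi> (inv\<^bsub>BijGroup E\<^esub> s) * \<phi> s = 1\<^sub>m n" "\<phi> s * \<phi> (inv\<^bsub>BijGroup E\<^esub> s) = 1\<^sub>m n"
      using s t by (simp_all add: \<phi>_mult[symmetric] \<phi>_one car)
    then show ?thesis
      unfolding GL_bit_simps by (auto simp: \<phi>_def)
  qed
  have hom: "\<phi> \<in> hom (BijGroup E) (GL_bit n)"
    using \<phi>_inv \<phi>_mult by (auto simp: hom_def car GL_bit_simps(2))
  have "inj_on \<phi> (carrier (BijGroup E))"
    unfolding inj_on_one_iff'[OF hom group_BijGroup group_GL_bit]
  proof (intro allI impI)
    fix s assume "s \<in> carrier (BijGroup E)" and one: "\<phi> s = \<one>\<^bsub>GL_bit n\<^esub>"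
    then have s: "s \<in> Bij E" by (simp add: car)
    have "T s i = i" if "i \<le> n" for i
      using sum_zero_mat_eq_one_imp_id[OF n T_inj[OF s] T_le[OF s] _ that] one
      by (simp add: \<phi>_def GL_bit_simps)
    then have "s x = x" if "x \<in> E" for x
      using T_im[OF that, of s] \<iota> that Bij_mem[OF s that] by (auto simp: inj_on_def)
    then show "s = \<one>\<^bsub>BijGroup E\<^esub>"
      using Bij_imp_extensional[OF s]
      by (intro extensionalityI[of _ E]) (auto simp: BijGroup_def)
  qed
  with hom show thesis by (rule that)
qed

section \<open>The Galois group as a group of permutations of the roots\<close>

lemma galois_group_simps:
  "carrier (galois_group L K)
    = {\<sigma> \<in> ring_iso L L \<inter> extensional (carrier L). \<forall>x\<in>K. \<sigma> x = x}"
  "\<one>\<^bsub>galois_group L K\<^esub> = (\<lambda>x\<in>carrier L. x)"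
  by (simp_all add: galois_group_def BijGroup_def)

lemma galois_group_carrier_Bij: "carrier (galois_group L K) \<subseteq> Bij (carrier L)"
  by (auto simp: galois_group_simps Bij_def ring_iso_def)

lemma galois_group_mult:
  assumes "\<sigma> \<in> carrier (galois_group L K)" "\<tau> \<in> carrier (galois_group L K)"
  shows "\<sigma> \<otimes>\<^bsub>galois_group L K\<^esub> \<tau> = compose (carrier L) \<sigma> \<tau>"
  using subsetD[OF galois_group_carrier_Bij assms(1)] subsetD[OF galois_group_carrier_Bij assms(2)]
  by (simp add: galois_group_def BijGroup_def)

lemma restrict_in_ring_iso:
  assumes "\<sigma> \<in> ring_iso R S" "ring R"
  shows "restrict \<sigma> (carrier R) \<in> ring_iso R S"
  by (rule ring.ring_iso_restrict[OF assms(2,1)]) simp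

lemma group_galois_group:
  assumes "field L" and "K \<subseteq> carrier L"
  shows "group (galois_group L K)"
proof -
  interpret field L by fact
  interpret B: group "BijGroup (carrier L)" by (rule group_BijGroup)
  have car: "carrier (BijGroup (carrier L)) = Bij (carrier L)" by (simp add: BijGroup_def)
  have "subgroup (carrier (galois_group L K)) (BijGroup (carrier L))"
  proof (rule B.subgroupI)
    show "carrier (galois_group L K) \<subseteq> carrier (BijGroup (carrier L))"
      using galois_group_carrier_Bij by (simp add: car)
    have "(\<lambda>x\<in>carrier L. x) \<in> carrier (galois_group L K)"
      using restrict_in_ring_iso[OF ring_iso_set_refl[unfolded id_def] ring_axioms] assms(2)
      by (auto simp: galois_group_simps)
    then show "carrier (galois_group L K) \<noteq> {}" by blast
  next
    fix \<sigma> assume \<sigma>: "\<sigma> \<in> carrier (galois_group L K)"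
    then have iso: "\<sigma> \<in> ring_iso L L" and fixed: "\<And>x. x \<in> K \<Longrightarrow> \<sigma> x = x"
      by (auto simp: galois_group_simps)
    have inj: "inj_on \<sigma> (carrier L)"
      using iso by (auto simp: ring_iso_def bij_betw_def)
    have "inv_into (carrier L) \<sigma> x = x" if "x \<in> K" for x
      using inv_into_f_f[OF inj, of x] fixed[OF that] that assms(2) by auto
    moreover have "restrict (inv_into (carrier L) \<sigma>) (carrier L) \<in> ring_iso L L"
      by (rule restrict_in_ring_iso[OF ring_iso_set_sym[OF ring_axioms iso] ring_axioms])
    ultimately show "inv\<^bsub>BijGroup (carrier L)\<^esub> \<sigma> \<in> carrier (galois_group L K)"
      using assms(2) inv_BijGroup[OF subsetD[OF galois_group_carrier_Bij \<sigma>]]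
      by (auto simp: galois_group_simps)
  next
    fix \<sigma> \<tau> assume \<sigma>: "\<sigma> \<in> carrier (galois_group L K)" and \<tau>: "\<tau> \<in> carrier (galois_group L K)"
    have "restrict (\<sigma> \<circ> \<tau>) (carrier L) \<in> ring_iso L L"
      by (rule restrict_in_ring_iso[OF ring_iso_set_trans ring_axioms])
        (use \<sigma> \<tau> in \<open>auto simp: galois_group_simps\<close>)
    then have "compose (carrier L) \<sigma> \<tau> \<in> ring_iso L L"
      by (simp add: compose_def comp_def)
    then have "compose (carrier L) \<sigma> \<tau> \<in> carrier (galois_group L K)"
      using \<sigma> \<tau> assms(2) by (auto simp: galois_group_simps compose_def)
    then show "\<sigma> \<otimes>\<^bsub>BijGroup (carrier L)\<^esub> \<tau> \<in> carrier (galois_group L K)"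
      using galois_group_mult[OF \<sigma> \<tau>] by (simp add: galois_group_def)
  qed
  then have "group (BijGroup (carrier L) \<lparr>carrier := carrier (galois_group L K)\<rparr>)"
    using B.group_axioms by (rule subgroup.subgroup_is_group)
  then show ?thesis by (simp add: galois_group_def)
qed

lemma galois_group_ring_hom_ring:
  assumes "field L" and "\<sigma> \<in> carrier (galois_group L K)"
  shows "ring_hom_ring L L \<sigma>"
proof -
  interpret field L by fact
  show ?thesis
    using assms(2) by (intro ring_hom_ringI2 ring_axioms) (auto simp: galois_group_simps ring_iso_def)
qed

text \<open>The fixed points of a field automorphism are closed under all the operations of the field.\<close>

lemma galois_fixing_generators_is_one:
  assumes L: "field L" and \<sigma>: "\<sigma> \<in> carrier (galois_group L K)"
    and gen: "generate_field L (K \<union> E) = carrier L"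
    and fixed: "\<And>x. x \<in> E \<Longrightarrow> \<sigma> x = x"
  shows "\<sigma> = \<one>\<^bsub>galois_group L K\<^esub>"
proof -
  interpret L: field L by fact
  interpret s: ring_hom_ring L L \<sigma> by (rule galois_group_ring_hom_ring[OF L \<sigma>])
  have fixK: "\<And>x. x \<in> K \<Longrightarrow> \<sigma> x = x" using \<sigma> by (simp add: galois_group_simps)
  have "\<sigma> x = x" if "x \<in> carrier L" for x
  proof -
    from that have "x \<in> generate_field L (K \<union> E)" by (simp add: gen)
    then show ?thesis
    proof (induction rule: generate_field.induct)
      case (m_inv x)
      have x: "x \<in> carrier L" using m_inv(1) by (simp add: gen)
      then have u: "x \<in> Units L" using m_inv(2) L.field_Units by simp
      then have i: "inv\<^bsub>L\<^esub> x \<in> carrier L" by simp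
      have "\<sigma> (inv\<^bsub>L\<^esub> x) \<otimes>\<^bsub>L\<^esub> x = \<sigma> (inv\<^bsub>L\<^esub> x \<otimes>\<^bsub>L\<^esub> x)"
        using x i m_inv(3) by simp
      also have "\<dots> = \<one>\<^bsub>L\<^esub>" using u by simp
      finally show ?case
        using L.comm_inv_char[of x "\<sigma> (inv\<^bsub>L\<^esub> x)"] x i by (simp add: L.m_comm)
    qed (use fixed fixK gen in auto)
  qed
  then show ?thesis
    using \<sigma> by (intro extensionalityI[of _ "carrier L"]) (auto simp: galois_group_simps)
qed

text \<open>
  Stability of a finite set \<open>E\<close> under an automorphism is enough for it to permute \<open>E\<close>, because
  an injective map of a finite set to itself is bijective.
\<close>

lemma galois_restrict_embeds_BijGroup:
  assumes L: "field L" and K: "K \<subseteq> carrier L" and E: "finite E" "E \<subseteq> carrier L"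
    and gen: "generate_field L (K \<union> E) = carrier L"
    and stable: "\<And>\<sigma> x. \<sigma> \<in> carrier (galois_group L K) \<Longrightarrow> x \<in> E \<Longrightarrow> \<sigma> x \<in> E"
  shows "(\<lambda>\<sigma>. restrict \<sigma> E) \<in> hom (galois_group L K) (BijGroup E)"
    and "inj_on (\<lambda>\<sigma>. restrict \<sigma> E) (carrier (galois_group L K))"
proof -
  have Bij: "restrict \<sigma> E \<in> Bij E" if \<sigma>: "\<sigma> \<in> carrier (galois_group L K)" for \<sigma>
  proof -
    have "inj_on \<sigma> (carrier L)"
      using subsetD[OF galois_group_carrier_Bij \<sigma>] by (simp add: Bij_def bij_betw_def)
    then have "inj_on \<sigma> E" using E(2) by (rule inj_on_subset)
    moreover have "\<sigma> ` E = E"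
      using E(1) stable[OF \<sigma>] \<open>inj_on \<sigma> E\<close> by (intro endo_inj_surj) auto
    ultimately show ?thesis by (simp add: Bij_def bij_betw_def)
  qed
  show hom: "(\<lambda>\<sigma>. restrict \<sigma> E) \<in> hom (galois_group L K) (BijGroup E)"
  proof (rule homI)
    fix \<sigma> \<tau> assume \<sigma>: "\<sigma> \<in> carrier (galois_group L K)" and \<tau>: "\<tau> \<in> carrier (galois_group L K)"
    have "restrict (compose (carrier L) \<sigma> \<tau>) E = compose E (restrict \<sigma> E) (restrict \<tau> E)"
      using E(2) stable[OF \<tau>] by (auto simp: compose_def fun_eq_iff)
    then show "restrict (\<sigma> \<otimes>\<^bsub>galois_group L K\<^esub> \<tau>) E
        = restrict \<sigma> E \<otimes>\<^bsub>BijGroup E\<^esub> restrict \<tau> E"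
      using Bij[OF \<sigma>] Bij[OF \<tau>] by (simp add: galois_group_mult[OF \<sigma> \<tau>] BijGroup_def)
  qed (simp add: BijGroup_def Bij)
  show "inj_on (\<lambda>\<sigma>. restrict \<sigma> E) (carrier (galois_group L K))"
    unfolding inj_on_one_iff'[OF hom group_galois_group[OF L K] group_BijGroup]
  proof (intro allI impI)
    fix \<sigma> assume \<sigma>: "\<sigma> \<in> carrier (galois_group L K)" and "restrict \<sigma> E = \<one>\<^bsub>BijGroup E\<^esub>"
    then have "\<sigma> x = x" if "x \<in> E" for x
      using that by (auto simp: BijGroup_def dest!: fun_cong[of _ _ x])
    with L \<sigma> gen show "\<sigma> = \<one>\<^bsub>galois_group L K\<^esub>"
      by (rule galois_fixing_generators_is_one)
  qed
qed

lemma galois_group_maps_roots_to_roots: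
  assumes L: "field L" and p: "p \<in> carrier (poly_ring L)" and K: "set p \<subseteq> K"
    and \<sigma>: "\<sigma> \<in> carrier (galois_group L K)" and x: "x \<in># ring.roots L p"
  shows "\<sigma> x \<in># ring.roots L p"
proof -
  interpret L: field L by fact
  interpret s: ring_hom_ring L L \<sigma> by (rule galois_group_ring_hom_ring[OF L \<sigma>])
  have root: "L.is_root p x" using x L.roots_mem_iff_is_root[OF p] by simp
  have "set p \<subseteq> carrier L"
    using L.polynomial_incl p unfolding sym[OF univ_poly_carrier] by blast
  moreover have "map \<sigma> p = p"
    using \<sigma> K by (auto simp: galois_group_simps intro: map_idI)
  ultimately have "L.eval p (\<sigma> x) = \<sigma> (L.eval p x)"
    using s.eval_hom'[of x p] root unfolding L.is_root_def by metis
  also have "\<dots> = \<zero>\<^bsub>L\<^esub>" using root by (simp add: L.is_root_def)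
  finally show ?thesis
    using root by (simp add: L.roots_mem_iff_is_root[OF p] L.is_root_def)
qed

lemma embedding_imp_iso_subgroup:
  assumes "group G" "group H" "\<phi> \<in> hom G H" "inj_on \<phi> (carrier G)"
  shows "\<exists>I. subgroup I H \<and> G \<cong> H\<lparr>carrier := I\<rparr>"
proof -
  interpret group_hom G H \<phi>
    using assms by (intro group_hom.intro group_hom_axioms.intro)
  have "\<phi> \<in> iso G (H\<lparr>carrier := \<phi> ` carrier G\<rparr>)"
    using assms(4) by (auto simp: iso_def hom_def bij_betw_def)
  then show ?thesis using img_is_subgroup is_isoI by blast
qed

theorem corollary1p1:
  fixes F :: "('a, 'm) ring_scheme" and L :: "('b, 'n) ring_scheme"
    and h :: "'a \<Rightarrow> 'b" and g :: nat and a :: "nat \<Rightarrow> 'a" and f :: "'a list"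
  assumes "perfect_field F" and "ring_char F \<noteq> 2"
    and "g \<ge> 1"
    and "\<And>i. i \<in> {1..2*g+1} \<Longrightarrow> a i \<in> carrier F"
    and "f = \<one>\<^bsub>F\<^esub> # map a [1..<2*g+2]"
    and "pirreducible\<^bsub>F\<^esub> (carrier F) f"
    and "splitting_field F f L h"
  shows "\<exists>H. subgroup H (GL_bit (2*g)) \<and>
             galois_group L (h ` carrier F) \<cong> (GL_bit (2*g))\<lparr>carrier := H\<rparr>"
proof -
  have L: "field L" and h: "h \<in> Ring.ring_hom F L"
    and gen: "generate_field L (h ` carrier F \<union> set_mset (ring.roots L (map h f))) = carrier L"
    using assms(7) by (auto simp: splitting_field_def)
  interpret F: field F using assms(1) by (simp add: perfect_field_def)
  interpret L: field L by fact
  interpret h: ring_hom_ring F L h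
    using h by (intro ring_hom_ringI2 F.ring_axioms L.ring_axioms)
  define K where "K = h ` carrier F"
  define E where "E = set_mset (L.roots (map h f))"
  have "set f \<subseteq> carrier F" using assms(4,5) by auto
  then have coeffs: "set (map h f) \<subseteq> K" by (auto simp: K_def)
  have K: "K \<subseteq> carrier L" by (auto simp: K_def)
  have p: "map h f \<in> carrier (poly_ring L)"
    unfolding sym[OF univ_poly_carrier] polynomial_def
    using coeffs K assms(5) by auto
  have "card E \<le> size (L.roots (map h f))"
    unfolding E_def size_multiset_overloaded_eq card_eq_sum
    by (rule sum_mono) (simp add: Suc_le_eq)
  also have "\<dots> \<le> Suc (2 * g)"
  proof -
    have "length (map h f) = 2 * g + 2" by (simp add: assms(5) del: upt_Suc)
    then show ?thesis using L.size_roots_le_degree[OF p] by linarith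
  qed
  finally have card: "card E \<le> Suc (2 * g)" .
  have fin: "finite E" by (simp add: E_def)
  have sub: "E \<subseteq> carrier L"
    using L.roots_mem_iff_is_root[OF p] by (auto simp: E_def L.is_root_def)
  have stable: "\<sigma> x \<in> E" if "\<sigma> \<in> carrier (galois_group L K)" "x \<in> E" for \<sigma> x
    using galois_group_maps_roots_to_roots[OF L p coeffs] that by (simp add: E_def)
  note embeds = galois_restrict_embeds_BijGroup[OF L K fin sub gen[folded K_def E_def]]
  have hom: "(\<lambda>\<sigma>. restrict \<sigma> E) \<in> hom (galois_group L K) (BijGroup E)"
    using stable by (rule embeds(1))
  have inj: "inj_on (\<lambda>\<sigma>. restrict \<sigma> E) (carrier (galois_group L K))"
    using stable by (rule embeds(2))
  obtain \<phi> where \<phi>: "\<phi> \<in> hom (BijGroup E) (GL_bit (2*g))" "inj_on \<phi> (carrier (BijGroup E))"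
    using BijGroup_embeds_GL_bit[of "2*g" E] assms(3) fin card by auto
  have "\<phi> \<circ> (\<lambda>\<sigma>. restrict \<sigma> E) \<in> hom (galois_group L K) (GL_bit (2*g))"
    using hom \<phi>(1) by (rule hom_compose)
  moreover have "inj_on (\<phi> \<circ> (\<lambda>\<sigma>. restrict \<sigma> E)) (carrier (galois_group L K))"
    using inj
  proof (rule comp_inj_on)
    show "inj_on \<phi> ((\<lambda>\<sigma>. restrict \<sigma> E) ` carrier (galois_group L K))"
      using hom by (intro inj_on_subset[OF \<phi>(2)] hom_carrier)
  qed
  ultimately show ?thesis
    unfolding K_def[symmetric]
    by (rule embedding_imp_iso_subgroup[OF group_galois_group[OF L K] group_GL_bit])
qed

end
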